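(* Let $\Gamma=\mathbb{Q}\rtimes\mathbb{Q}^+$ be the countable group of affine maps $x\mapsto ax+b$ of $\mathbb{R}$ with $a\in\mathbb{Q}$, $a>0$, $b\in\mathbb{Q}$, acting naturally on $\mathbb{R}$, and let $\mu$ be any probability measure on $\mathbb{R}$ in the measure class of Lebesgue measure. Then the nonsingular system $(\mathbb{R},\mu,\Gamma)$ is SAT (hence EIC) but not doubly ergodic.
   Context: A nonsingular action of a group $\Gamma$ on a standard probability space $(X,\mathcal{B},\mu)$ is a measurable action preserving the measure class of $\mu$. SAT (strongly almost transitive): for every measurable $A\subset X$ with $\mu(A)>0$ there is a sequence $\{g_n\}\subset\Gamma$ with $\mu(g_nA)\to1$. EIC (ergodic with isometric coefficients): there is no non-constant Borel measurable equivariant map $\phi:X\to Z$, where $(Z,d)$ is a separable metric space on which $\Gamma$ acts by isometries (equivariant: for each $g$, $\phi(gx)=g\phi(x)$ for $\mu$-a.e. $x$; non-constant: not $\mu$-a.e. equal to a constant). Ergodic: every measurable $B$ with $\mu(gB\,\triangle\,B)=0$ for all $g$ has $\mu(B)\in\{0,1\}$. Doubly ergodic: the diagonal action on $(X\times X,\mu\times\mu)$ is ergodic. *)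

theory Defs
  imports "HOL-Probability.Probability" "HOL-Algebra.Group_Action"
begin

definition separable_space :: "'a topology \<Rightarrow> bool" where
  "separable_space T \<longleftrightarrow>
     (\<exists>D. countable D \<and> D \<subseteq> topspace T \<and> T closure_of D = topspace T)"

definition standard_borel_space :: "'a measure \<Rightarrow> bool" where
  "standard_borel_space M \<longleftrightarrow>
     (\<exists>T. completely_metrizable_space T \<and> separable_space T \<and> topspace T = space M \<and>
          sets M = sigma_sets (space M) {U. openin T U})"

definition standard_probability_space :: "'a measure \<Rightarrow> bool" where
  "standard_probability_space M \<longleftrightarrow> prob_space M \<and> standard_borel_space M"

definition same_measure_class :: "'a measure \<Rightarrow> 'a measure \<Rightarrow> bool" where
  "same_measure_class M N \<longleftrightarrow>
     sets M = sets N \<and> absolutely_continuous M N \<and> absolutely_continuous N M"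

text \<open>Groups are discrete here, so an action is measurable when each group element acts by a
  measurable map.\<close>

definition nonsingular_action ::
    "('g, 'm) monoid_scheme \<Rightarrow> 'a measure \<Rightarrow> ('g \<Rightarrow> 'a \<Rightarrow> 'a) \<Rightarrow> bool" where
  "nonsingular_action G M \<phi> \<longleftrightarrow>
     standard_probability_space M \<and>
     group_action G (space M) \<phi> \<and>
     (\<forall>g\<in>carrier G. \<phi> g \<in> measurable M M \<and> same_measure_class (distr M M (\<phi> g)) M)"

definition SAT ::
    "('g, 'm) monoid_scheme \<Rightarrow> 'a measure \<Rightarrow> ('g \<Rightarrow> 'a \<Rightarrow> 'a) \<Rightarrow> bool" where
  "SAT G M \<phi> \<longleftrightarrow>
     (\<forall>A\<in>sets M. measure M A > 0 \<longrightarrow>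
        (\<exists>g :: nat \<Rightarrow> 'g. (\<forall>n. g n \<in> carrier G) \<and>
           (\<lambda>n. measure M (\<phi> (g n) ` A)) \<longlonglongrightarrow> 1))"

definition isometric_action ::
    "('g, 'm) monoid_scheme \<Rightarrow> 'z set \<Rightarrow> ('z \<Rightarrow> 'z \<Rightarrow> real) \<Rightarrow> ('g \<Rightarrow> 'z \<Rightarrow> 'z) \<Rightarrow> bool" where
  "isometric_action G Z d \<psi> \<longleftrightarrow>
     group_action G Z \<psi> \<and>
     (\<forall>g\<in>carrier G. \<forall>x\<in>Z. \<forall>y\<in>Z. d (\<psi> g x) (\<psi> g y) = d x y)"

text \<open>A definition cannot quantify over types, so the type \<open>'z\<close> containing the coefficient spaces
  is a parameter; \<open>EIC TYPE('z)\<close> with \<open>'z\<close> a free type variable of a theorem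
  covers all separable metric spaces. The carrier \<open>Z\<close> is an arbitrary subset of \<open>'z\<close>.\<close>

definition EIC ::
    "'z itself \<Rightarrow> ('g, 'm) monoid_scheme \<Rightarrow> 'a measure \<Rightarrow> ('g \<Rightarrow> 'a \<Rightarrow> 'a) \<Rightarrow> bool" where
  "EIC _ G M \<phi> \<longleftrightarrow>
     \<not> (\<exists>(Z :: 'z set) d \<psi> f.
          Metric_space Z d \<and> separable_space (Metric_space.mtopology Z d) \<and>
          isometric_action G Z d \<psi> \<and>
          f \<in> measurable M (sigma Z {U. openin (Metric_space.mtopology Z d) U}) \<and>
          (\<forall>g\<in>carrier G. AE x in M. f (\<phi> g x) = \<psi> g (f x)) \<and>
          \<not> (\<exists>c\<in>Z. AE x in M. f x = c))"

definition ergodic ::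
    "('g, 'm) monoid_scheme \<Rightarrow> 'a measure \<Rightarrow> ('g \<Rightarrow> 'a \<Rightarrow> 'a) \<Rightarrow> bool" where
  "ergodic G M \<phi> \<longleftrightarrow>
     (\<forall>B\<in>sets M. (\<forall>g\<in>carrier G. measure M (sym_diff (\<phi> g ` B) B) = 0) \<longrightarrow>
        measure M B = 0 \<or> measure M B = 1)"

text \<open>The restriction makes the result an element of \<open>Bij (X \<times> X)\<close>, whose members are
  extensional functions.\<close>

definition diagonal_action :: "'a set \<Rightarrow> ('g \<Rightarrow> 'a \<Rightarrow> 'a) \<Rightarrow> 'g \<Rightarrow> 'a \<times> 'a \<Rightarrow> 'a \<times> 'a" where
  "diagonal_action X \<phi> g = (\<lambda>(x, y)\<in>X \<times> X. (\<phi> g x, \<phi> g y))"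

definition doubly_ergodic ::
    "('g, 'm) monoid_scheme \<Rightarrow> 'a measure \<Rightarrow> ('g \<Rightarrow> 'a \<Rightarrow> 'a) \<Rightarrow> bool" where
  "doubly_ergodic G M \<phi> \<longleftrightarrow> ergodic G (M \<Otimes>\<^sub>M M) (diagonal_action (space M) \<phi>)"

text \<open>The group of rational orientation-preserving affine maps, under composition: the semidirect
  product of the translations by \<open>\<rat>\<close> with the positive rational dilations. Since its elements
  are maps of the line, its natural action is evaluation, \<open>\<lambda>g x. g x\<close>.\<close>

definition rational_affine_group :: "(real \<Rightarrow> real) monoid" where
  "rational_affine_group =
     (BijGroup (UNIV :: real set))
       \<lparr>carrier := {(\<lambda>x. a * x + b) | a b. a \<in> \<rat> \<and> a > 0 \<and> b \<in> \<rat>}\<rparr>"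

definition affine_action :: "(real \<Rightarrow> real) \<Rightarrow> real \<Rightarrow> real" where
  "affine_action g x = g x"

end

theory Submission
  imports Defs
begin

text \<open>A set of positive Lebesgue measure nearly fills some interval with rational endpoints, and
  rational affine maps blow such an interval up to \<open>[-N, N]\<close>. Doing this with summable errors,
  Borel--Cantelli shows that almost every point eventually lies in the images, so by dominated
  convergence their \<open>\<mu>\<close>-measure tends to 1. Double ergodicity fails because orientation-preserving
  maps leave the half-plane \<open>y < x\<close> invariant.\<close>

section \<open>From SAT to EIC\<close>

text \<open>Translates of a ball preimage of positive measure are ball preimages of the same radius, with
  measure tending to 1. Once two of them have measure above \<open>1/2\<close> they meet, so a single
  ball of three times the radius carries the whole pushforward.\<close>

lemma SAT_imp_EIC:
  assumes "prob_space M" and act: "group_action G (space M) \<phi>" and sat: "SAT G M \<phi>"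
  shows "EIC TYPE('z) G M \<phi>"
  unfolding EIC_def
proof (intro notI, elim exE conjE)
  fix Z :: "'z set" and d \<psi> f
  assume "Metric_space Z d" and sep: "separable_space (Metric_space.mtopology Z d)"
    and iso: "isometric_action G Z d \<psi>"
    and f: "f \<in> measurable M (sigma Z {U. openin (Metric_space.mtopology Z d) U})"
    and equiv: "\<forall>g\<in>carrier G. AE x in M. f (\<phi> g x) = \<psi> g (f x)"
    and nonconst: "\<not> (\<exists>c\<in>Z. AE x in M. f x = c)"
  interpret prob_space M by fact
  interpret Z: Metric_space Z d by fact
  interpret act: group_action G "space M" \<phi> by fact
  interpret G: group G using act.group_hom by (simp add: group_hom_def)
  interpret iso: group_action G Z \<psi> using iso by (simp add: isometric_action_def)
  have opens: "{U. openin Z.mtopology U} \<subseteq> Pow Z"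
    using openin_subset by fastforce
  have fZ: "f x \<in> Z" if "x \<in> space M" for x
    using measurable_space[OF f that] by (simp add: space_measure_of[OF opens])
  define P where "P w r = {x \<in> space M. f x \<in> Z.mball w r}" for w r
  have P_sets [measurable]: "P w r \<in> sets M" for w r
  proof -
    have "Z.mball w r \<in> sets (sigma Z {U. openin Z.mtopology U})"
      using opens by (auto simp: sets_measure_of)
    from measurable_sets[OF f this] show ?thesis
      by (simp add: P_def vimage_def Int_def conj_commute)
  qed
  have translate: "measure M (\<phi> g ` P z r) \<le> measure M (P (\<psi> g z) r)"
    if g: "g \<in> carrier G" and z: "z \<in> Z" for g z r
  \<comment> \<open>Only the larger set has to be measurable here: a non-measurable image would have
    measure 0 by default.\<close>
  proof (rule finite_measure_mono_AE)
    \<comment> \<open>Equivariance is taken at the inverse of \<open>g\<close>, so that the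
      exceptional null set is one of image points \<open>y\<close> and need not be moved by
      \<open>\<phi> g\<close>.\<close>
    have "AE y in M. f (\<phi> (inv\<^bsub>G\<^esub> g) y) = \<psi> (inv\<^bsub>G\<^esub> g) (f y)"
      using equiv g by auto
    then show "AE y in M. y \<in> \<phi> g ` P z r \<longrightarrow> y \<in> P (\<psi> g z) r"
    proof (eventually_elim, intro impI)
      fix y assume y: "f (\<phi> (inv\<^bsub>G\<^esub> g) y) = \<psi> (inv\<^bsub>G\<^esub> g) (f y)" and "y \<in> \<phi> g ` P z r"
      then obtain x where x: "x \<in> space M" "f x \<in> Z.mball z r" "y = \<phi> g x"
        by (auto simp: P_def)
      then have yM: "y \<in> space M"
        using g act.element_image by blast
      have "\<phi> (inv\<^bsub>G\<^esub> g) y = x"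
        using act.orbit_sym_aux[OF g x(1)] x(3) by simp
      then have fx: "f x = \<psi> (inv\<^bsub>G\<^esub> g) (f y)"
        using y by simp
      have "\<psi> g (f x) = f y"
        using iso.orbit_sym_aux[OF _ fZ[OF yM] fx[symmetric]] g by simp
      moreover have "d (\<psi> g z) (\<psi> g (f x)) = d z (f x)"
        using iso g z fZ[OF x(1)] by (auto simp: isometric_action_def)
      moreover have "\<psi> g z \<in> Z"
        using iso.element_image[OF g z refl] .
      ultimately show "y \<in> P (\<psi> g z) r"
        using x yM fZ[OF yM] by (auto simp: P_def)
    qed
  qed simp
  \<comment> \<open>Separability enters here: the balls of radius \<open>r\<close> around a
    countable dense set cover \<open>Z\<close>, so their preimages cannot all be null.\<close>
  have pos: "\<exists>z\<in>Z. 0 < measure M (P z r)" if "r > 0" for r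
  proof (rule ccontr)
    assume neg: "\<not> ?thesis"
    obtain D where D: "countable D" "D \<subseteq> Z" "Z.mtopology closure_of D = Z"
      using sep by (auto simp: separable_space_def)
    have avoid: "AE x in M. \<forall>z\<in>D. x \<notin> P z r"
    proof (subst AE_ball_countable[OF D(1)], intro ballI)
      fix z assume "z \<in> D"
      then have "measure M (P z r) = 0"
        using neg D(2) zero_less_measure_iff by blast
      then show "AE x in M. x \<notin> P z r"
        by (subst prob_eq_0[symmetric]) auto
    qed
    have cover: "\<exists>z\<in>D. x \<in> P z r" if "x \<in> space M" for x
    proof -
      have "f x \<in> Z.mtopology closure_of D"
        using fZ[OF that] D(3) by simp
      then obtain z where "z \<in> D" "z \<in> Z.mball (f x) r"
        using \<open>r > 0\<close> unfolding Z.metric_closure_of by blast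
      then show ?thesis
        using that by (auto simp: P_def Z.commute)
    qed
    have "AE x in M. False"
      using avoid AE_space
    proof eventually_elim
      case (elim x)
      then show ?case using cover[of x] by blast
    qed
    then show False by simp
  qed
  have full: "\<exists>w\<in>Z. measure M (P w (3 * r)) = 1" if "0 < r" for r
  proof -
    obtain z where z: "z \<in> Z" "0 < measure M (P z r)"
      using pos[OF \<open>0 < r\<close>] by blast
    obtain g where g: "\<And>n :: nat. g n \<in> carrier G"
      and lim: "(\<lambda>n. measure M (\<phi> (g n) ` P z r)) \<longlonglongrightarrow> 1"
      using sat z(2) unfolding SAT_def by (metis P_sets)
    define w where "w n = \<psi> (g n) z" for n
    have wZ: "w n \<in> Z" for n
      using iso.element_image[OF g z(1) refl] by (simp add: w_def)
    have lim: "(\<lambda>n. measure M (P (w n) r)) \<longlonglongrightarrow> 1"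
      by (rule tendsto_sandwich[OF _ _ lim tendsto_const])
         (auto simp: w_def translate g z(1))
    have "\<forall>\<^sub>F n in sequentially. measure M (P (w n) r) > 1/2"
      by (rule order_tendstoD[OF lim]) simp
    then obtain N where N: "\<And>n. n \<ge> N \<Longrightarrow> measure M (P (w n) r) > 1/2"
      by (auto simp: eventually_sequentially)
    \<comment> \<open>The index \<open>N\<close> stays fixed while \<open>n\<close> grows, so the
      one set at \<open>w N\<close> dominates a sequence of measures tending to 1.\<close>
    have "measure M (P (w n) r) \<le> measure M (P (w N) (3 * r))" if "n \<ge> N" for n
    proof (rule finite_measure_mono)
      have "P (w n) r \<inter> P (w N) r \<noteq> {}"
      proof
        assume "P (w n) r \<inter> P (w N) r = {}"
        then have "measure M (P (w n) r \<union> P (w N) r) > 1"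
          using N[OF that] N[of N] by (subst finite_measure_Union) auto
        then show False
          using prob_le_1[of "P (w n) r \<union> P (w N) r"] by linarith
      qed
      then obtain x where x: "x \<in> P (w n) r" "x \<in> P (w N) r" by blast
      show "P (w n) r \<subseteq> P (w N) (3 * r)"
      proof
        fix y assume y: "y \<in> P (w n) r"
        have "d (w N) (f y) \<le> d (w N) (f x) + d (f x) (f y)"
          using x y wZ by (auto simp: P_def intro: Z.triangle)
        also have "d (f x) (f y) \<le> d (w n) (f x) + d (w n) (f y)"
          using x y wZ by (auto simp: P_def intro: Z.triangle'')
        finally show "y \<in> P (w N) (3 * r)"
          using x y wZ by (auto simp: P_def)
      qed
    qed simp
    then have "1 \<le> measure M (P (w N) (3 * r))"
      by (intro LIMSEQ_le_const2[OF lim]) auto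
    then show ?thesis
      using wZ[of N] prob_le_1[of "P (w N) (3 * r)"] by (intro bexI[of _ "w N"]) auto
  qed
  \<comment> \<open>Radii tending to 0 turn concentration into constancy: almost every point lies in
    all of these preimages, and two such points have the same value under \<open>f\<close>. The
    centres \<open>w k\<close> need not be nested.\<close>
  have "\<forall>k. \<exists>w\<in>Z. measure M (P w (3 * inverse (Suc k))) = 1"
    using full by simp
  then obtain w where w: "\<And>k. w k \<in> Z" "\<And>k. measure M (P (w k) (3 * inverse (Suc k))) = 1"
    by metis
  have "AE x in M. \<forall>k. x \<in> P (w k) (3 * inverse (Suc k))"
    using w(2) by (subst AE_all_countable) (auto simp: prob_eq_1)
  then have ae: "AE x in M. x \<in> space M \<and> (\<forall>k. x \<in> P (w k) (3 * inverse (Suc k)))"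
    by auto
  have "\<exists>x. x \<in> space M \<and> (\<forall>k. x \<in> P (w k) (3 * inverse (Suc k)))"
  proof (rule ccontr)
    assume "\<not> ?thesis"
    then have "AE x in M. False"
      by (intro eventually_mono[OF ae]) blast
    then show False by simp
  qed
  then obtain x where x: "x \<in> space M" "\<And>k. x \<in> P (w k) (3 * inverse (Suc k))"
    by blast
  have eq: "f y = f x" if y: "\<And>k. y \<in> P (w k) (3 * inverse (Suc k))" "y \<in> space M" for y
  proof (rule ccontr)
    assume "f y \<noteq> f x"
    \<comment> \<open>Two points of a ball of radius \<open>3 * inverse (Suc k)\<close> are less
      than \<open>6 * inverse (Suc k)\<close> apart, hence the 6.\<close>
    then have "d (f y) (f x) / 6 > 0"
      using fZ x(1) y(2) by simp
    then obtain k where k: "inverse (real (Suc k)) < d (f y) (f x) / 6"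
      using reals_Archimedean by blast
    have "d (f y) (f x) \<le> d (w k) (f y) + d (w k) (f x)"
      using fZ x(1) y(2) w(1) by (intro Z.triangle'') auto
    also have "\<dots> < 3 * inverse (Suc k) + 3 * inverse (Suc k)"
      using x(2)[of k] y(1)[of k] by (intro add_strict_mono) (auto simp: P_def)
    finally show False using k by linarith
  qed
  have "AE y in M. f y = f x"
    using ae by eventually_elim (use eq in blast)
  then show False
    using nonconst fZ[OF x(1)] by blast
qed

section \<open>A density lemma for intervals with rational endpoints\<close>

lemma fmeasurable_lborel_interval:
  fixes a b :: real
  shows "{a..b} \<in> fmeasurable lborel" "{a<..<b} \<in> fmeasurable lborel"
proof -
  show "{a..b} \<in> fmeasurable lborel"
    by (rule fmeasurableI) (simp_all add: emeasure_lborel_Icc_eq)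
  then show "{a<..<b} \<in> fmeasurable lborel"
    by (rule fmeasurableI2) auto
qed

text \<open>If every rational interval missed more than the proportion \<open>\<epsilon>\<close>,
  then so, up to equality, would every open interval. A tight covering of a bounded piece of
  \<open>A\<close> by nonoverlapping intervals would then waste at least \<open>\<epsilon>\<close>
  times the measure of that piece, although the waste can be made smaller.\<close>

lemma rational_interval_density:
  assumes A [measurable]: "A \<in> sets borel" and A_pos: "emeasure lborel A > 0" and "\<epsilon> > 0"
  obtains c d :: real where "c \<in> \<rat>" "d \<in> \<rat>" "c < d" "measure lborel ({c..d} - A) \<le> \<epsilon> * (d - c)"
proof (rule ccontr)
  note result = that
  assume neg: "\<not> thesis"
  have sparse: "\<epsilon> * (d - c) \<le> measure lborel ({c<..<d} - A)" if "c < d" for c d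
  proof (rule ccontr)
    assume less: "\<not> ?thesis"
    define m where "m = measure lborel ({c<..<d} - A)"
    \<comment> \<open>Trimming less than \<open>t\<close> from each end leaves length at least
      \<open>m / \<epsilon>\<close>. A rational interval obtained in this way would satisfy the
      bound that \<open>neg\<close> excludes.\<close>
    define t where "t = (d - c - m / \<epsilon>) / 2"
    have "m / \<epsilon> < d - c"
      using less \<open>\<epsilon> > 0\<close> by (simp add: m_def field_simps)
    moreover have "m / \<epsilon> \<ge> 0"
      using \<open>\<epsilon> > 0\<close> by (simp add: m_def)
    ultimately have t: "0 < t" "2 * t \<le> d - c"
      by (auto simp: t_def)
    obtain c' where c': "c' \<in> \<rat>" "c < c'" "c' < c + t"
      using Rats_dense_in_real[of c "c + t"] t by auto
    obtain d' where d': "d' \<in> \<rat>" "d - t < d'" "d' < d"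
      using Rats_dense_in_real[of "d - t" d] t by auto
    have "m / \<epsilon> \<le> d' - c'"
      using c' d' by (simp add: t_def field_simps)
    then have "m \<le> \<epsilon> * (d' - c')"
      using \<open>\<epsilon> > 0\<close> by (simp add: field_simps)
    moreover have "measure lborel ({c'..d'} - A) \<le> m"
      unfolding m_def
    proof (rule measure_mono_fmeasurable)
      show "{c<..<d} - A \<in> fmeasurable lborel"
        by (rule fmeasurable_Diff[OF fmeasurable_lborel_interval(2)]) simp
    qed (use c' d' in auto)
    ultimately show False
      using result[OF c'(1) d'(1)] c' d' t neg by linarith
  qed
  have "\<exists>k::nat. emeasure lborel (A \<inter> {-real k..real k}) \<noteq> 0"
  proof (rule ccontr)
    assume "\<not> ?thesis"
    then have "(\<Union>k::nat. A \<inter> {-real k..real k}) \<in> null_sets lborel"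
      by (intro null_sets_UN) (auto simp: null_sets_def)
    moreover have "(\<Union>k::nat. A \<inter> {-real k..real k}) = A"
    proof -
      have "\<exists>k::nat. -real k \<le> x \<and> x \<le> real k" for x
        using real_arch_simple[of "\<bar>x\<bar>"] by (force simp: abs_le_iff)
      then show ?thesis by auto
    qed
    ultimately show False
      using A_pos by auto
  qed
  then obtain k :: nat where k: "emeasure lborel (A \<inter> {-real k..real k}) \<noteq> 0" ..
  define S where "S = A \<inter> {-real k..real k}"
  have S [measurable]: "S \<in> sets borel"
    by (simp add: S_def)
  have S_fm: "S \<in> fmeasurable lborel"
    unfolding S_def by (rule fmeasurableI2[OF fmeasurable_lborel_interval(1)]) auto
  then have S_lm: "S \<in> lmeasurable"
    by (auto simp: fmeasurable_def)
  define m where "m = measure lborel S"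
  have "m > 0"
    using k S_fm by (auto simp: m_def S_def measure_def fmeasurable_def enn2real_positive_iff
        zero_less_iff_neq_zero)
  \<comment> \<open>The excess allowed to the covering is half of the waste
    \<open>\<epsilon> * m\<close> that sparsity will force.\<close>
  define e where "e = \<epsilon> * m / 2"
  have "e > 0"
    using \<open>m > 0\<close> \<open>\<epsilon> > 0\<close> by (simp add: e_def)
  \<comment> \<open>A box with nonempty interior is what makes the covering intervals
    nondegenerate.\<close>
  have "k \<noteq> 0"
  proof
    assume "k = 0"
    then have "S \<subseteq> {0}" by (auto simp: S_def)
    then have "m = 0"
      by (metis (no_types) countable_finite countable_imp_null_set_lborel countable_subset
          finite.emptyI finite_insert m_def measure_eq_0_null_sets)
    then show False using \<open>m > 0\<close> by simp
  qed
  then have "box (-real k) (real k) \<noteq> {}" by simp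
  have "S \<subseteq> cbox (-real k) (real k)" by (auto simp: S_def)
  from measurable_outer_intervals_bounded[OF S_lm this \<open>e > 0\<close>]
  obtain \<D> where \<D>: "countable \<D>" "\<And>K. K \<in> \<D> \<Longrightarrow> K \<noteq> {} \<and> (\<exists>c d. K = cbox c d)"
      "pairwise (\<lambda>A B. interior A \<inter> interior B = {}) \<D>"
      "\<And>K. K \<in> \<D> \<Longrightarrow> interior K \<noteq> {}"
      "S \<subseteq> \<Union>\<D>" "\<Union>\<D> \<in> lmeasurable" "measure lebesgue (\<Union>\<D>) \<le> measure lebesgue S + e"
    using \<open>box (-real k) (real k) \<noteq> {}\<close> by metis
  \<comment> \<open>The interiors are genuinely disjoint, so their measures add up; passing to them
    loses only the countably many endpoints.\<close>
  define U where "U = (\<Union>K\<in>\<D>. interior K)"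
  have U [measurable]: "U \<in> sets borel"
    unfolding U_def by (intro borel_open open_UN) auto
  have "countable (\<Union>K\<in>\<D>. K - interior K)"
  proof (intro countable_UN \<D>(1))
    fix K assume "K \<in> \<D>"
    then obtain c d where "K = cbox c d"
      using \<D>(2) by blast
    then have "K - interior K \<subseteq> {c, d}"
      by (auto simp: interior_cbox)
    then show "countable (K - interior K)"
      by (meson countable_finite finite.emptyI finite_insert finite_subset)
  qed
  then have "countable (S - U)"
    using \<D>(5) by (rule_tac countable_subset) (auto simp: U_def)
  then have "emeasure lborel (S - U) = 0"
    using countable_imp_null_set_lborel by blast
  moreover have "emeasure lborel S \<le> emeasure lborel (U \<union> (S - U))"
    by (intro emeasure_mono) auto
  moreover have "\<dots> \<le> emeasure lborel U + emeasure lborel (S - U)"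
    by (intro emeasure_subadditive) auto
  ultimately have S_U: "emeasure lborel S \<le> emeasure lborel U"
    by simp
  have disj: "disjoint_family_on interior \<D>"
    using \<D>(3) by (auto simp: disjoint_family_on_def pairwise_def)
  \<comment> \<open>The sum over the countable family \<D> is written as an integral over
    \<open>count_space\<close>. Termwise sparsity bounds \<open>\<epsilon>\<close> times the measure
    of \<open>U\<close> by the measure of \<open>U - S\<close>, which is at most \<open>e\<close>;
    but \<open>U\<close> has measure at least \<open>m\<close>.\<close>
  have "ennreal \<epsilon> * emeasure lborel U
      = (\<integral>\<^sup>+K. ennreal \<epsilon> * emeasure lborel (interior K) \<partial>count_space \<D>)"
    unfolding U_def
    by (subst emeasure_UN_countable[OF _ \<D>(1) disj]) (auto simp: nn_integral_cmult)
  also have "\<dots> \<le> (\<integral>\<^sup>+K. emeasure lborel (interior K - S) \<partial>count_space \<D>)"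
  proof (rule nn_integral_mono)
    fix K assume "K \<in> space (count_space \<D>)"
    then have "K \<in> \<D>" by simp
    then obtain c d where K: "K = cbox c d"
      using \<D>(2) by blast
    then have int: "interior K = {c<..<d}"
      by (simp add: interior_cbox box_real)
    then have "c < d"
      using \<D>(4)[OF \<open>K \<in> \<D>\<close>] by simp
    have "ennreal \<epsilon> * emeasure lborel (interior K) = ennreal (\<epsilon> * (d - c))"
      using \<open>c < d\<close> \<open>\<epsilon> > 0\<close> by (simp add: int ennreal_mult)
    also have "\<dots> \<le> ennreal (measure lborel ({c<..<d} - A))"
      by (intro ennreal_leI sparse \<open>c < d\<close>)
    also have "\<dots> = emeasure lborel ({c<..<d} - A)"
    proof (rule emeasure_eq_measure2[symmetric])
      show "{c<..<d} - A \<in> fmeasurable lborel"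
        by (rule fmeasurable_Diff[OF fmeasurable_lborel_interval(2)]) simp
    qed
    also have "\<dots> \<le> emeasure lborel (interior K - S)"
      by (intro emeasure_mono) (auto simp: int S_def)
    finally show "ennreal \<epsilon> * emeasure lborel (interior K) \<le> emeasure lborel (interior K - S)" .
  qed
  also have "\<dots> = emeasure lborel (\<Union>K\<in>\<D>. interior K - S)"
    using disj by (subst emeasure_UN_countable[OF _ \<D>(1)]) (auto simp: disjoint_family_on_def)
  also have "(\<Union>K\<in>\<D>. interior K - S) = U - S"
    by (auto simp: U_def)
  also have "emeasure lborel (U - S) = emeasure lebesgue (U - S)"
    by simp
  also have "\<dots> \<le> emeasure lebesgue (\<Union>\<D> - S)"
  proof (rule emeasure_mono)
    show "U - S \<subseteq> \<Union>\<D> - S"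
      using interior_subset unfolding U_def by blast
    show "\<Union>\<D> - S \<in> sets lebesgue"
      using \<D>(6) S_lm by blast
  qed
  also have "\<dots> = ennreal (measure lebesgue (\<Union>\<D> - S))"
    using \<D>(6) S_lm by (intro emeasure_eq_measure2) blast
  also have "\<dots> \<le> ennreal e"
  proof (rule ennreal_leI)
    have "measure lebesgue (\<Union>\<D> - S) = measure lebesgue (\<Union>\<D>) - measure lebesgue S"
      using \<D>(5,6) S_lm by (intro measurable_measure_Diff) auto
    then show "measure lebesgue (\<Union>\<D> - S) \<le> e"
      using \<D>(7) by linarith
  qed
  finally have "ennreal \<epsilon> * emeasure lborel U \<le> ennreal e" .
  moreover have "ennreal m \<le> emeasure lborel U"
    using S_U S_fm by (simp add: m_def emeasure_eq_measure2)
  then have "ennreal (\<epsilon> * m) \<le> ennreal \<epsilon> * emeasure lborel U"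
    using \<open>\<epsilon> > 0\<close> \<open>m > 0\<close> by (simp add: ennreal_mult mult_left_mono)
  ultimately have "ennreal (\<epsilon> * m) \<le> ennreal e"
    by (rule order_trans[rotated])
  then show False
    using \<open>e > 0\<close> \<open>\<epsilon> > 0\<close> \<open>m > 0\<close> by (simp add: e_def)
qed

section \<open>Lebesgue measure of affine images\<close>

lemma affine_image_eq_vimage:
  fixes a b :: real
  assumes "a > 0"
  shows "(\<lambda>x. a * x + b) ` E = (\<lambda>x. (x - b) / a) -` E"
proof -
  have "y = a * ((y - b) / a) + b" for y
    using assms by simp
  then show ?thesis
    using assms by (auto intro!: image_eqI)
qed

lemma affine_image_borel:
  fixes a b :: real
  assumes "a > 0" "E \<in> sets borel"
  shows "(\<lambda>x. a * x + b) ` E \<in> sets borel"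
proof -
  have "(\<lambda>x. (x - b) / a) \<in> measurable borel borel" by simp
  from measurable_sets[OF this assms(2)] show ?thesis
    using assms(1) by (simp add: affine_image_eq_vimage)
qed

lemma emeasure_lborel_affine_image:
  fixes a b :: real
  assumes "a > 0" and E [measurable]: "E \<in> sets borel"
  shows "emeasure lborel ((\<lambda>x. a * x + b) ` E) = ennreal a * emeasure lborel E"
proof -
  let ?F = "(\<lambda>x. a * x + b) ` E"
  have F [measurable]: "?F \<in> sets borel"
    using affine_image_borel assms by blast
  \<comment> \<open>The argument has the form \<open>b + a * x\<close> produced by the substitution
    rule \<open>nn_integral_real_affine\<close>.\<close>
  have ind: "indicator ?F (b + a * x) = (indicator E x :: ennreal)" for x
    using assms by (auto simp: indicator_def)
  have "emeasure lborel ?F = (\<integral>\<^sup>+x. indicator ?F x \<partial>lborel)"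
    by simp
  also have "\<dots> = ennreal a * (\<integral>\<^sup>+x. indicator E x \<partial>lborel)"
    using assms by (subst nn_integral_real_affine[of _ a b]) (simp_all only: ind, auto)
  finally show ?thesis by simp
qed

section \<open>The rational affine group and its action\<close>

lemma rational_affine_carrier:
  "g \<in> carrier rational_affine_group \<longleftrightarrow>
     (\<exists>a b. g = (\<lambda>x. a * x + b) \<and> a \<in> \<rat> \<and> a > 0 \<and> b \<in> \<rat>)"
  by (simp add: rational_affine_group_def)

lemma countable_rational_affine_group: "countable (carrier rational_affine_group)"
proof (rule countable_subset)
  show "carrier rational_affine_group \<subseteq> (\<lambda>(a, b) x. a * x + b) ` (\<rat> \<times> \<rat>)"
    by (auto simp: rational_affine_carrier)
  show "countable ((\<lambda>(a, b) x. a * x + b) ` (\<rat> \<times> \<rat> :: (real \<times> real) set))"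
    by (intro countable_image countable_SIGMA countable_rat)
qed

text \<open>Supplies the group laws and makes the inclusion into \<open>BijGroup UNIV\<close> a
  homomorphism, from which the action is obtained.\<close>

lemma subgroup_rational_affine:
  "subgroup (carrier rational_affine_group) (BijGroup UNIV)"
proof -
  let ?H = "carrier rational_affine_group"
  have inv: "(\<lambda>x. (x - b) / a) \<in> ?H" if "a \<in> \<rat>" "a > 0" "b \<in> \<rat>" for a b :: real
    unfolding rational_affine_carrier
    using that by (intro exI[of _ "1 / a"] exI[of _ "- b / a"]) (auto simp: diff_divide_distrib)
  have bij: "?H \<subseteq> Bij UNIV"
  proof
    fix g assume "g \<in> ?H"
    then obtain a b where g: "g = (\<lambda>x. a * x + b)" "a > 0"
      by (auto simp: rational_affine_carrier)
    then have "bij g"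
      by (intro o_bij[of "\<lambda>x. (x - b) / a"]) (auto simp: o_def field_simps)
    then show "g \<in> Bij UNIV" by (simp add: Bij_def)
  qed
  show ?thesis
  proof (rule group.subgroupI[OF group_BijGroup])
    show "?H \<subseteq> carrier (BijGroup UNIV)"
      using bij by (simp add: BijGroup_def)
    have "(\<lambda>x. 1 * x + 0) \<in> ?H"
      unfolding rational_affine_carrier by (intro exI[of _ 1] exI[of _ 0]) auto
    then show "?H \<noteq> {}" by blast
  next
    fix g assume g: "g \<in> ?H"
    then obtain a b where ab: "g = (\<lambda>x. a * x + b)" "a \<in> \<rat>" "a > 0" "b \<in> \<rat>"
      by (auto simp: rational_affine_carrier)
    have h: "(\<lambda>x. (x - b) / a) \<in> ?H"
      using inv ab by blast
    have "inv\<^bsub>BijGroup UNIV\<^esub> g = (\<lambda>x. (x - b) / a)"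
    proof (rule group.inv_equality[OF group_BijGroup])
      show "(\<lambda>x. (x - b) / a) \<otimes>\<^bsub>BijGroup UNIV\<^esub> g = \<one>\<^bsub>BijGroup UNIV\<^esub>"
        using g h bij ab by (auto simp: BijGroup_def compose_def subset_iff)
    qed (use g h bij in \<open>auto simp: BijGroup_def\<close>)
    then show "inv\<^bsub>BijGroup UNIV\<^esub> g \<in> ?H"
      using h by simp
  next
    fix g h assume gh: "g \<in> ?H" "h \<in> ?H"
    then obtain a b a' b' where ab: "g = (\<lambda>x. a * x + b)" "a \<in> \<rat>" "a > 0" "b \<in> \<rat>"
        "h = (\<lambda>x. a' * x + b')" "a' \<in> \<rat>" "a' > 0" "b' \<in> \<rat>"
      by (auto simp: rational_affine_carrier)
    have "g \<otimes>\<^bsub>BijGroup UNIV\<^esub> h = (\<lambda>x. (a * a') * x + (a * b' + b))"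
      using gh bij by (auto simp: BijGroup_def compose_def subset_iff ab algebra_simps)
    then show "g \<otimes>\<^bsub>BijGroup UNIV\<^esub> h \<in> ?H"
      unfolding rational_affine_carrier using ab
      by (intro exI[of _ "a * a'"] exI[of _ "a * b' + b"]) auto
  qed
qed

lemma group_action_affine: "group_action rational_affine_group UNIV affine_action"
proof -
  have "group_hom (BijGroup UNIV\<lparr>carrier := carrier rational_affine_group\<rparr>) (BijGroup UNIV) id"
    by (rule group.canonical_inj_is_hom[OF group_BijGroup subgroup_rational_affine])
  moreover have "BijGroup UNIV\<lparr>carrier := carrier rational_affine_group\<rparr> = rational_affine_group"
    by (simp add: rational_affine_group_def)
  \<comment> \<open>Evaluation, curried, is the identity on functions, so the action is exactly this
    inclusion.\<close>
  moreover have "affine_action = id"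
    by (simp add: affine_action_def fun_eq_iff)
  ultimately show ?thesis
    by (simp add: group_action_def)
qed

section \<open>Nonsingularity\<close>

lemma standard_borel_space_borel:
  fixes M :: "'a :: polish_space measure"
  assumes "sets M = sets borel"
  shows "standard_borel_space M"
proof -
  obtain D :: "'a set" where D: "countable D" "\<And>X. open X \<Longrightarrow> X \<noteq> {} \<Longrightarrow> \<exists>d\<in>D. d \<in> X"
    using countable_dense_exists by blast
  have "closure D = UNIV"
    using D(2) by (auto simp: closure_iff_nhds_not_empty) blast
  then have "separable_space (euclidean :: 'a topology)"
    using D(1) by (auto simp: separable_space_def)
  moreover have "space M = UNIV"
    using sets_eq_imp_space_eq[OF assms] by simp
  ultimately show ?thesis
    unfolding standard_borel_space_def using assms
    by (intro exI[of _ euclidean])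
       (auto simp: completely_metrizable_space_euclidean borel_def)
qed

lemma null_sets_same_measure_class:
  "same_measure_class M N \<Longrightarrow> null_sets M = null_sets N"
  by (auto simp: same_measure_class_def absolutely_continuous_def)

text \<open>The null sets of \<open>\<mu>\<close> are those of Lebesgue measure, and an affine map
  only multiplies the latter by a positive factor.\<close>

lemma nonsingular_affine:
  assumes "prob_space \<mu>" and cls: "same_measure_class \<mu> lborel"
  shows "nonsingular_action rational_affine_group \<mu> affine_action"
proof -
  have sets [measurable_cong]: "sets \<mu> = sets borel"
    using cls by (simp add: same_measure_class_def)
  then have space: "space \<mu> = UNIV"
    using sets_eq_imp_space_eq[OF sets] by simp
  have meas: "affine_action g \<in> measurable \<mu> \<mu>"
    and "same_measure_class (distr \<mu> \<mu> (affine_action g)) \<mu>"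
    if g: "g \<in> carrier rational_affine_group" for g
  proof -
    obtain a b where g: "g = (\<lambda>x. a * x + b)" "a > 0"
      using g by (auto simp: rational_affine_carrier)
    then have eq: "affine_action g = (\<lambda>x. a * x + b)"
      by (auto simp: affine_action_def)
    show meas: "affine_action g \<in> measurable \<mu> \<mu>"
      unfolding eq by measurable
    have "E \<in> null_sets (distr \<mu> \<mu> (affine_action g)) \<longleftrightarrow> E \<in> null_sets \<mu>" for E
    proof (cases "E \<in> sets borel")
      case True
      let ?E' = "(\<lambda>x. a * x + b) -` E"
      have E': "?E' \<in> sets borel"
        using measurable_sets[OF meas] True by (simp add: eq sets space)
      have im: "(\<lambda>x. a * x + b) ` ?E' = E"
        using g(2) by (auto simp: affine_image_eq_vimage)
      have "E \<in> null_sets (distr \<mu> \<mu> (affine_action g)) \<longleftrightarrow> ?E' \<in> null_sets \<mu>"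
        using meas True E' by (simp add: null_sets_distr_iff eq sets space)
      also have "\<dots> \<longleftrightarrow> emeasure lborel ?E' = 0"
        unfolding null_sets_same_measure_class[OF cls] using E' by (simp add: null_sets_def)
      also have "\<dots> \<longleftrightarrow> emeasure lborel E = 0"
        using emeasure_lborel_affine_image[OF g(2) E', of b] g(2) unfolding im by simp
      also have "\<dots> \<longleftrightarrow> E \<in> null_sets \<mu>"
        unfolding null_sets_same_measure_class[OF cls] using True by (simp add: null_sets_def)
      finally show ?thesis .
    qed (auto simp: null_sets_def sets)
    then show "same_measure_class (distr \<mu> \<mu> (affine_action g)) \<mu>"
      by (auto simp: same_measure_class_def absolutely_continuous_def)
  qed
  then show ?thesis
    using assms(1) standard_borel_space_borel[OF sets] group_action_affine
    by (simp add: nonsingular_action_def standard_probability_space_def space)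
qed

section \<open>The SAT property\<close>

text \<open>Stretching an interval \<open>{c..d}\<close> to length \<open>2 * real N\<close>
  multiplies the part missed by \<open>A\<close> by \<open>2 * real N / (d - c)\<close>, so density
  is requested with \<open>\<epsilon> / (2 * real N)\<close>.\<close>

lemma affine_image_almost_covers_interval:
  assumes A [measurable]: "A \<in> sets borel" "emeasure lborel A > 0" and "\<epsilon> > 0" and "N > (0::nat)"
  shows "\<exists>g\<in>carrier rational_affine_group.
    measure lborel ({-real N..real N} - g ` A) \<le> \<epsilon>"
proof -
  obtain c d where cd: "c \<in> \<rat>" "d \<in> \<rat>" "c < d"
    and le: "measure lborel ({c..d} - A) \<le> (\<epsilon> / (2 * real N)) * (d - c)"
    using rational_interval_density[OF assms(1,2), of "\<epsilon> / (2 * real N)"] assms(3,4)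
    by (metis divide_pos_pos mult_pos_pos of_nat_0_less_iff zero_less_numeral)
  \<comment> \<open>These are the coefficients of the increasing affine map taking \<open>c\<close>
    to \<open>- real N\<close> and \<open>d\<close> to \<open>real N\<close>; they are rational
    because \<open>c\<close> and \<open>d\<close> are.\<close>
  define a where "a = 2 * real N / (d - c)"
  define b where "b = - real N - a * c"
  let ?g = "\<lambda>x. a * x + b"
  have a: "a > 0" "a \<in> \<rat>"
    using cd assms(4) by (auto simp: a_def)
  have b: "b \<in> \<rat>"
    using cd a by (auto simp: b_def)
  have inj: "inj ?g"
    using a by (auto simp: inj_def)
  have "?g ` {c..d} = {-real N..real N}"
  proof -
    have "?g ` {c..d} = {a * c + b..a * d + b}"
      using a(1) cd(3) by (subst image_affinity_atLeastAtMost) auto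
    also have "a * d + b = a * (d - c) - real N"
      by (simp add: b_def algebra_simps)
    also have "a * (d - c) = 2 * real N"
      using cd(3) by (simp add: a_def)
    finally show ?thesis by (simp add: b_def)
  qed
  then have "{-real N..real N} - ?g ` A = ?g ` ({c..d} - A)"
    using image_set_diff[OF inj, of "{c..d}" A] by simp
  then have "measure lborel ({-real N..real N} - ?g ` A) = a * measure lborel ({c..d} - A)"
    using emeasure_lborel_affine_image[OF a(1), of "{c..d} - A" b] a(1)
    by (simp add: measure_def enn2real_mult)
  also have "\<dots> \<le> a * ((\<epsilon> / (2 * real N)) * (d - c))"
    using le a(1) by (intro mult_left_mono) auto
  also have "\<dots> = \<epsilon>"
    using cd(3) assms(4) by (simp add: a_def)
  finally show ?thesis
    using a b by (intro bexI[of _ ?g]) (auto simp: rational_affine_carrier)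
qed

lemma SAT_affine:
  assumes "prob_space \<mu>" and cls: "same_measure_class \<mu> lborel"
  shows "SAT rational_affine_group \<mu> affine_action"
  unfolding SAT_def
proof (intro ballI impI)
  interpret prob_space \<mu> by fact
  have sets: "sets \<mu> = sets borel"
    using cls by (simp add: same_measure_class_def)
  then have space: "space \<mu> = UNIV"
    using sets_eq_imp_space_eq[OF sets] by simp
  fix A assume "A \<in> sets \<mu>" and pos: "measure \<mu> A > 0"
  then have A [measurable]: "A \<in> sets borel" by (simp add: sets)
  have "A \<notin> null_sets lborel"
    using pos by (auto simp: null_sets_same_measure_class[OF cls, symmetric] measure_eq_0_null_sets)
  then have "emeasure lborel A > 0"
    using A by (simp add: null_sets_def zero_less_iff_neq_zero)
  \<comment> \<open>\<open>Suc n\<close> keeps the interval nondegenerate at \<open>n = 0\<close>,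
    and the errors form a geometric series, as Borel-Cantelli requires.\<close>
  then have "\<forall>n. \<exists>g\<in>carrier rational_affine_group.
      measure lborel ({-real (Suc n)..real (Suc n)} - g ` A) \<le> (1/2) ^ n"
    by (intro allI affine_image_almost_covers_interval) auto
  then obtain g where g: "\<And>n. g n \<in> carrier rational_affine_group"
    and small: "\<And>n. measure lborel ({-real (Suc n)..real (Suc n)} - g n ` A) \<le> (1/2) ^ n"
    by metis
  have gA [measurable]: "g n ` A \<in> sets borel" for n
    using g[of n] affine_image_borel[OF _ A] by (auto simp: rational_affine_carrier)
  let ?E = "\<lambda>n. {-real (Suc n)..real (Suc n)} - g n ` A"
  have "AE x in lborel. \<forall>\<^sub>F n in sequentially. x \<in> space lborel - ?E n"
  proof (rule borel_cantelli_AE1)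
    show "emeasure lborel (?E n) < \<infinity>" for n
      by (rule le_less_trans[OF emeasure_mono[of _ "{-real (Suc n)..real (Suc n)}"]]) auto
    show "summable (\<lambda>n. measure lborel (?E n))"
      by (rule summable_comparison_test'[of "\<lambda>n. (1/2) ^ n" 0]) (use small in auto)
  qed auto
  then have "AE x in lborel. \<forall>\<^sub>F n in sequentially. x \<in> g n ` A"
  proof eventually_elim
    fix x :: real assume ev: "\<forall>\<^sub>F n in sequentially. x \<in> space lborel - ?E n"
    \<comment> \<open>Once \<open>n\<close> exceeds the absolute value of \<open>x\<close>, the
      point lies in the interval, so avoiding the exceptional set means lying in \<open>g n\<close>
      followed by \<open>A\<close> as an image.\<close>
    have "\<forall>\<^sub>F n in sequentially. nat \<lceil>\<bar>x\<bar>\<rceil> \<le> n"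
      by (rule eventually_ge_at_top)
    with ev show "\<forall>\<^sub>F n in sequentially. x \<in> g n ` A"
    proof eventually_elim
      case (elim n)
      then have "\<bar>x\<bar> \<le> real (Suc n)" by linarith
      then show ?case using elim(1) by (auto simp: abs_le_iff)
    qed
  qed
  then have ae: "AE x in \<mu>. \<forall>\<^sub>F n in sequentially. x \<in> g n ` A"
    by (rule absolutely_continuous_AE[rotated 2])
       (use cls in \<open>auto simp: same_measure_class_def\<close>)
  \<comment> \<open>The almost-everywhere statement has been moved to \<open>\<mu>\<close> because
    this measure is finite, which makes the constant 1 an integrable bound.\<close>
  have "(\<lambda>n. \<integral>x. indicat_real (g n ` A) x \<partial>\<mu>) \<longlonglongrightarrow> (\<integral>x. 1 \<partial>\<mu>)"
  proof (rule integral_dominated_convergence[where w = "\<lambda>_. 1"])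
    show "AE x in \<mu>. (\<lambda>n. indicat_real (g n ` A) x) \<longlonglongrightarrow> 1"
      using ae
    proof eventually_elim
      case (elim x)
      then show ?case
        by (intro tendsto_eventually) (auto elim: eventually_mono)
    qed
  qed (auto simp: sets intro!: borel_measurable_indicator)
  then have "(\<lambda>n. measure \<mu> (g n ` A)) \<longlonglongrightarrow> 1"
    using prob_space by (simp add: space)
  moreover have "affine_action (g n) ` A = g n ` A" for n
    by (simp add: affine_action_def)
  ultimately show "\<exists>g. (\<forall>n. g n \<in> carrier rational_affine_group) \<and>
      (\<lambda>n. measure \<mu> (affine_action (g n) ` A)) \<longlonglongrightarrow> 1"
    using g by (intro exI[of _ g]) simp
qed

section \<open>Failure of double ergodicity\<close>

lemma not_doubly_ergodic_affine:
  assumes "prob_space \<mu>" and cls: "same_measure_class \<mu> lborel"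
  shows "\<not> doubly_ergodic rational_affine_group \<mu> affine_action"
proof
  assume erg: "doubly_ergodic rational_affine_group \<mu> affine_action"
  interpret prob_space \<mu> by fact
  interpret P: pair_prob_space \<mu> \<mu> ..
  have sets [measurable_cong]: "sets \<mu> = sets borel"
    using cls by (simp add: same_measure_class_def)
  then have space: "space \<mu> = UNIV"
    using sets_eq_imp_space_eq[OF sets] by simp
  define B where "B = {p :: real \<times> real. snd p < fst p}"
  have "B = {p \<in> space (\<mu> \<Otimes>\<^sub>M \<mu>). snd p < fst p}"
    by (simp add: B_def space_pair_measure space)
  also have "\<dots> \<in> sets (\<mu> \<Otimes>\<^sub>M \<mu>)"
    by measurable
  finally have B [measurable]: "B \<in> sets (\<mu> \<Otimes>\<^sub>M \<mu>)" .
  \<comment> \<open>Increasing maps with increasing inverses preserve the half-plane exactly, so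
    every symmetric difference in \<open>ergodic\<close> is empty.\<close>
  have "diagonal_action (space \<mu>) affine_action g ` B = B"
    if carr: "g \<in> carrier rational_affine_group" for g
  proof -
    obtain a b where g: "g = (\<lambda>x. a * x + b)" "a > 0"
      using carr by (auto simp: rational_affine_carrier)
    have inv: "a * ((x - b) / a) + b = x" for x
      using g(2) by simp
    have "p \<in> (\<lambda>(x, y). (a * x + b, a * y + b)) ` B" if "p \<in> B" for p
      using that g(2)
      by (intro image_eqI[of _ _ "((fst p - b) / a, (snd p - b) / a)"])
         (auto simp: B_def inv divide_strict_right_mono)
    then have "(\<lambda>(x, y). (a * x + b, a * y + b)) ` B = B"
      using g(2) by (auto simp: B_def)
    then show ?thesis
      by (simp add: diagonal_action_def affine_action_def space g)
  qed
  then have zero_one: "measure (\<mu> \<Otimes>\<^sub>M \<mu>) B = 0 \<or> measure (\<mu> \<Otimes>\<^sub>M \<mu>) B = 1"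
    using erg B by (simp add: doubly_ergodic_def ergodic_def)
  have pos: "measure \<mu> C > 0" if C: "C \<in> sets borel" "I \<subseteq> C" "emeasure lborel I \<noteq> 0" for C I
  proof (rule ccontr)
    assume "\<not> ?thesis"
    then have "measure \<mu> C = 0"
      using measure_nonneg[of \<mu> C] by linarith
    then have "C \<in> null_sets \<mu>"
      using C(1) by (simp add: null_sets_def sets emeasure_eq_measure)
    then have "C \<in> null_sets lborel"
      using null_sets_same_measure_class[OF cls] by simp
    then have "emeasure lborel I \<le> 0"
      using emeasure_mono[OF C(2), of lborel] C(1) by (simp add: null_sets_def)
    then show False
      using C(3) by simp
  qed
  \<comment> \<open>Unit intervals serve as witnesses since their Lebesgue measure is finite and
    evaluates directly.\<close>
  have half: "measure \<mu> {0<..} > 0" "measure \<mu> {..0} > 0"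
    using pos[of "{0<..}" "{0<..<1}"] pos[of "{..0}" "{-1<..<0}"] by (simp_all add: subset_iff)
  have rect: "measure (\<mu> \<Otimes>\<^sub>M \<mu>) (C \<times> D) > 0"
    if "measure \<mu> C > 0" "measure \<mu> D > 0" "C \<in> sets borel" "D \<in> sets borel" for C D
  proof -
    have "emeasure (\<mu> \<Otimes>\<^sub>M \<mu>) (C \<times> D) = emeasure \<mu> C * emeasure \<mu> D"
      using that by (intro emeasure_pair_measure_Times) (simp_all add: sets)
    then have "measure (\<mu> \<Otimes>\<^sub>M \<mu>) (C \<times> D) = measure \<mu> C * measure \<mu> D"
      by (simp add: measure_def enn2real_mult)
    then show ?thesis
      using that by simp
  qed
  \<comment> \<open>One quadrant lies in \<open>B\<close> and the opposite one in its complement.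
    Both have positive product measure, so \<open>B\<close> has measure strictly between 0 and
    1.\<close>
  have "measure (\<mu> \<Otimes>\<^sub>M \<mu>) ({0<..} \<times> {..0}) \<le> measure (\<mu> \<Otimes>\<^sub>M \<mu>) B"
    by (intro P.finite_measure_mono B) (auto simp: B_def)
  then have "measure (\<mu> \<Otimes>\<^sub>M \<mu>) B \<noteq> 0"
    using rect[OF half] by force
  moreover have "measure (\<mu> \<Otimes>\<^sub>M \<mu>) ({..0} \<times> {0<..})
      \<le> measure (\<mu> \<Otimes>\<^sub>M \<mu>) (space (\<mu> \<Otimes>\<^sub>M \<mu>) - B)"
    by (intro P.finite_measure_mono sets.compl_sets B)
       (auto simp: B_def space_pair_measure space)
  then have "measure (\<mu> \<Otimes>\<^sub>M \<mu>) B \<noteq> 1"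
    using rect[OF half(2,1)] P.prob_compl[OF B] by force
  ultimately show False
    using zero_one by blast
qed

theorem proposition3p6:
  fixes \<mu> :: "real measure"
  assumes "prob_space \<mu>"
    and "same_measure_class \<mu> lborel"
  shows "countable (carrier rational_affine_group) \<and>
         nonsingular_action rational_affine_group \<mu> affine_action \<and>
         SAT rational_affine_group \<mu> affine_action \<and>
         EIC TYPE('z) rational_affine_group \<mu> affine_action \<and>
         \<not> doubly_ergodic rational_affine_group \<mu> affine_action"
  \<comment> \<open>The group action that \<open>SAT_imp_EIC\<close> asks for is a component of
    nonsingularity.\<close>
  using countable_rational_affine_group nonsingular_affine[OF assms] SAT_affine[OF assms]
    not_doubly_ergodic_affine[OF assms] SAT_imp_EIC[OF assms(1)]
  by (auto simp: nonsingular_action_def)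

end
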